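(* Let $(x^k)_{k\in\mathbb{N}}$ be the infinite sequence generated by the M-FW algorithm. Assume that $\mathcal{X}$ is $(\alpha,q)$-uniformly convex for some $\alpha>0$ and $q\ge 2$, and that $F$ is strongly convex, i.e. for every $j\in\mathcal{J}$ there is $\mu_j>0$ such that $F_j(y)\ge F_j(x)+\langle\nabla F_j(x),y-x\rangle+\frac{\mu_j}{2}\|y-x\|^2$ for all $x,y\in\mathcal{X}$; put $\mu:=\min_{j\in\mathcal{J}}\mu_j$. Let $$k_0:=\max\left\{\left\lfloor\log_2\left(\frac{D_{\mathcal{X}}^2}{2}\left(\frac{\alpha^2\mu}{8L}\right)^{1/(q-1)}\right)\right\rfloor+2,\;1\right\}.$$ Then $$\hat h(x^k)\le\begin{cases}\dfrac{L D_{\mathcal{X}}^2}{2^k},&\text{for }1\le k\le k_0,\\[2mm]\left(\dfrac{8}{\alpha^2\mu}\right)^{1/(q-1)}\left(\dfrac{2qL}{2q+(q-1)(k-k_0)}\right)^{\frac{q}{q-1}}=\mathcal{O}\left(1/k^{\frac{q}{q-1}}\right),&\text{for }k>k_0,\end{cases}$$ and $$\sum_{i=\ell}^{k}\min\left\{|\theta^{FW}(x^i)|,\frac{|\theta^{FW}(x^i)|^2}{L\|d^{FW}(x^i)\|^2}\right\}\le 2\hat h(x^\ell),\qquad\forall k\ge \ell\ge 1.$$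
   Context: Setting. $\mathcal{Y}$ is a finite-dimensional real vector space with an inner product $\langle\cdot,\cdot\rangle$ and a norm $\|\cdot\|$ (not necessarily induced by the inner product); gradients are taken with respect to $\langle\cdot,\cdot\rangle$. $\mathcal{X}\subset\mathcal{Y}$ is nonempty, convex and compact, $D_{\mathcal{X}}:=\max\{\|x-y\|:x,y\in\mathcal{X}\}$, $\mathcal{J}:=\{1,\dots,m\}$, and the problem is $\min_{x\in\mathcal{X}}F(x)=(F_1(x),\dots,F_m(x))$. Standing assumption: for every $j\in\mathcal{J}$, $F_j:V\to\mathbb{R}$ is convex and continuously differentiable ($V\subset\mathcal{Y}$ an open set containing $\mathcal{X}$) and $L_j$-smooth over $\mathcal{X}$, i.e. $$F_j(x)+\langle\nabla F_j(x),y-x\rangle\le F_j(y)\le F_j(x)+\langle\nabla F_j(x),y-x\rangle+\tfrac{L_j}{2}\|y-x\|^2\quad\forall x,y\in\mathcal{X}.$$ Set $L:=\max_{j\in\mathcal{J}}L_j>0$. $\mathbb{N}$ contains $0$. Multiobjective Frank-Wolfe (M-FW) algorithm. Start from $x^0\in\mathcal{X}$. At iteration $k$ choose $p^{FW}(x^k)\in\arg\min_{y\in\mathcal{X}}\max_{j\in\mathcal{J}}\langle\nabla F_j(x^k),y-x^k\rangle$, and let $d^{FW}(x^k):=p^{FW}(x^k)-x^k$, $\theta^{FW}(x^k):=\max_{j\in\mathcal{J}}\langle\nabla F_j(x^k),d^{FW}(x^k)\rangle$ (always $\le 0$). If $\theta^{FW}(x^k)=0$, stop. Otherwise set $\gamma_k:=\min\left\{1,\frac{-\theta^{FW}(x^k)}{L\|d^{FW}(x^k)\|^2}\right\}$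 and $x^{k+1}:=x^k+\gamma_k d^{FW}(x^k)$. It is assumed that the algorithm never stops, so it generates an infinite sequence $(x^k)_{k\in\mathbb{N}}$ with $\theta^{FW}(x^k)<0$ for all $k$. Fix a limit point $x^*$ of $(x^k)_{k\in\mathbb{N}}$ (under strong convexity the whole sequence converges to $x^*$) and define $h_j(x^k):=F_j(x^k)-F_j(x^* )$ and $\hat h(x^k):=\min_{j\in\mathcal{J}}h_j(x^k)$. For $\alpha>0$, $q\ge2$, the set $\mathcal{X}$ is $(\alpha,q)$-uniformly convex if for all $x,y\in\mathcal{X}$, $\gamma\in[0,1]$ and $z\in\mathcal{Y}$ with $\|z\|\le1$, one has $x+\gamma(y-x)+\gamma(1-\gamma)\frac{\alpha}{2}\|y-x\|^q z\in\mathcal{X}$. *)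

theory Defs
  imports "HOL-Analysis.Analysis" "HOL-Library.Landau_Symbols"
begin

(* A norm on the underlying space that need not come from the inner product.
   In finite dimension it induces the topology of the type class, so open, compact and
   tendsto are used from the library. *)
definition is_norm :: "('a::real_vector \<Rightarrow> real) \<Rightarrow> bool" where
  "is_norm N \<longleftrightarrow>
     (\<forall>x. N x = 0 \<longleftrightarrow> x = 0) \<and>
     (\<forall>c x. N (c *\<^sub>R x) = \<bar>c\<bar> * N x) \<and>
     (\<forall>x y. N (x + y) \<le> N x + N y)"

(* The supremum is attained when X is nonempty and compact. *)
definition diam_wrt :: "('a::real_vector \<Rightarrow> real) \<Rightarrow> 'a set \<Rightarrow> real" where
  "diam_wrt N X = Sup {N (x - y) | x y. x \<in> X \<and> y \<in> X}"

(* V is not assumed to be convex: convexity is required along every segment contained in V.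
   For convex V this is convex_on V f. *)
definition convex_along :: "'a::real_vector set \<Rightarrow> ('a \<Rightarrow> real) \<Rightarrow> bool" where
  "convex_along V f \<longleftrightarrow>
     (\<forall>x\<in>V. \<forall>y\<in>V. closed_segment x y \<subseteq> V \<longrightarrow> convex_on (closed_segment x y) f)"

(* g is the gradient of f in the following definitions. *)
definition smooth_over ::
  "('a::real_inner \<Rightarrow> real) \<Rightarrow> 'a set \<Rightarrow> real \<Rightarrow> ('a \<Rightarrow> real) \<Rightarrow> ('a \<Rightarrow> 'a) \<Rightarrow> bool" where
  "smooth_over N X L f g \<longleftrightarrow>
     (\<forall>x\<in>X. \<forall>y\<in>X. f x + g x \<bullet> (y - x) \<le> f y \<and>
        f y \<le> f x + g x \<bullet> (y - x) + L / 2 * (N (y - x))\<^sup>2)"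

definition strongly_convex_over ::
  "('a::real_inner \<Rightarrow> real) \<Rightarrow> 'a set \<Rightarrow> real \<Rightarrow> ('a \<Rightarrow> real) \<Rightarrow> ('a \<Rightarrow> 'a) \<Rightarrow> bool" where
  "strongly_convex_over N X \<mu> f g \<longleftrightarrow>
     (\<forall>x\<in>X. \<forall>y\<in>X. f y \<ge> f x + g x \<bullet> (y - x) + \<mu> / 2 * (N (y - x))\<^sup>2)"

definition uniformly_convex_set ::
  "('a::real_vector \<Rightarrow> real) \<Rightarrow> real \<Rightarrow> real \<Rightarrow> 'a set \<Rightarrow> bool" where
  "uniformly_convex_set N \<alpha> q X \<longleftrightarrow>
     (\<forall>x\<in>X. \<forall>y\<in>X. \<forall>\<gamma>\<in>{0..1}. \<forall>z. N z \<le> 1 \<longrightarrow>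
        x + \<gamma> *\<^sub>R (y - x) + (\<gamma> * (1 - \<gamma>) * (\<alpha> / 2) * N (y - x) powr q) *\<^sub>R z \<in> X)"

(* G j is the gradient field of the j-th objective. *)
definition lin_max :: "nat \<Rightarrow> (nat \<Rightarrow> 'a::real_inner \<Rightarrow> 'a) \<Rightarrow> 'a \<Rightarrow> 'a \<Rightarrow> real" where
  "lin_max m G x y = (MAX j\<in>{1..m}. G j x \<bullet> (y - x))"

(* x is an infinite run of the method (the stopping test never succeeds), and p k is the
   minimizer chosen in iteration k, so lin_max m G (x k) (p k) is the k-th value of theta. *)
definition mfw_run ::
  "('a::real_inner \<Rightarrow> real) \<Rightarrow> 'a set \<Rightarrow> nat \<Rightarrow> (nat \<Rightarrow> 'a \<Rightarrow> 'a) \<Rightarrow> real \<Rightarrow>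
   (nat \<Rightarrow> 'a) \<Rightarrow> (nat \<Rightarrow> 'a) \<Rightarrow> bool" where
  "mfw_run N X m G L x p \<longleftrightarrow>
     x 0 \<in> X \<and>
     (\<forall>k. is_arg_min (lin_max m G (x k)) (\<lambda>y. y \<in> X) (p k) \<and>
          lin_max m G (x k) (p k) \<noteq> 0 \<and>
          x (Suc k) = x k +
            min 1 (- lin_max m G (x k) (p k) / (L * (N (p k - x k))\<^sup>2)) *\<^sub>R (p k - x k))"

definition h_hat :: "nat \<Rightarrow> (nat \<Rightarrow> 'a \<Rightarrow> real) \<Rightarrow> 'a \<Rightarrow> 'a \<Rightarrow> real" where
  "h_hat m F xs x = (MIN j\<in>{1..m}. F j x - F j xs)"

end

theory Submission
  imports Defs
begin

text \<open>Write \<open>g\<close> for \<open>- \<theta>\<close> and \<open>n\<close> for the length of the direction. The descent lemma makes every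
  objective decrease by at least half of \<open>min g (g\<^sup>2 / (L n\<^sup>2))\<close> per step, so the smallest gap \<open>h\<close>
  does as well, and summing gives the last estimate. Convexity at the limit point gives \<open>h \<le> g\<close>.
  Perturbing the midpoint of \<open>x\<close> and \<open>p\<close> inside \<open>X\<close> towards the limit point and using strong convexity
  and AM-GM gives \<open>g\<^sup>2 \<ge> c n\<^bsup>2q\<^esup> h\<close> with \<open>c = \<alpha>\<^sup>2 \<mu> / 8\<close>. Eliminating \<open>g\<close> and \<open>n\<close> leaves the scalar
  recursion \<open>h' \<le> h - h min 1 ((h / T) powr b) / 2\<close> with \<open>b = (q - 1) / q\<close> and \<open>T powr b = L / c powr (1 / q)\<close>,
  which halves \<open>h\<close> until it is below \<open>T\<close> and then makes \<open>(h / T) powr (- b)\<close> grow by \<open>b / 2\<close> per step.\<close>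

section \<open>Norms other than the Euclidean one, and the diameter\<close>

lemma is_normD:
  assumes "is_norm N"
  shows "N 0 = 0" "N x = 0 \<longleftrightarrow> x = 0" "N (c *\<^sub>R x) = \<bar>c\<bar> * N x" "N (x + y) \<le> N x + N y"
    and "N (- x) = N x" "0 \<le> N x"
proof -
  show z: "N 0 = 0" and "N x = 0 \<longleftrightarrow> x = 0" and s: "N (c *\<^sub>R x) = \<bar>c\<bar> * N x" for c x
    using assms by (auto simp: is_norm_def)
  show t: "N (x + y) \<le> N x + N y" for x y
    using assms by (auto simp: is_norm_def)
  show m: "N (- x) = N x" using s[of "-1" x] by simp
  show "0 \<le> N x" using t[of x "- x"] z m by simp
qed

text \<open>Expanding \<open>x\<close> in the standard basis bounds \<open>N\<close> by a multiple
  of the Euclidean norm; this turns boundedness of a set into boundedness of the distances whose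
  supremum is \<open>diam_wrt\<close>.\<close>

lemma is_norm_le_norm:
  fixes N :: "'a::euclidean_space \<Rightarrow> real"
  assumes "is_norm N"
  shows "N x \<le> (\<Sum>b\<in>Basis. N b) * norm x"
proof -
  have *: "N (\<Sum>b\<in>A. f b) \<le> (\<Sum>b\<in>A. N (f b))" if "finite A" for A :: "'a set" and f
    using that
  proof (induction A rule: finite_induct)
    case empty
    then show ?case by (simp add: is_normD(1)[OF assms])
  next
    case (insert a A)
    then show ?case using is_normD(4)[OF assms, of "f a" "sum f A"] by simp
  qed
  have "N x = N (\<Sum>b\<in>Basis. (x \<bullet> b) *\<^sub>R b)" by (simp add: euclidean_representation)
  also have "\<dots> \<le> (\<Sum>b\<in>Basis. N ((x \<bullet> b) *\<^sub>R b))" by (rule *) simp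
  also have "\<dots> = (\<Sum>b\<in>Basis. \<bar>x \<bullet> b\<bar> * N b)" by (simp add: is_normD(3)[OF assms])
  also have "\<dots> \<le> (\<Sum>b\<in>Basis. norm x * N b)"
    by (intro sum_mono mult_right_mono Basis_le_norm is_normD(6)[OF assms])
  also have "\<dots> = (\<Sum>b\<in>Basis. N b) * norm x" by (simp add: sum_distrib_left mult.commute)
  finally show ?thesis .
qed

lemma le_diam_wrt:
  fixes N :: "'a::euclidean_space \<Rightarrow> real"
  assumes N: "is_norm N" and "bounded X" "x \<in> X" "y \<in> X"
  shows "N (x - y) \<le> diam_wrt N X"
  unfolding diam_wrt_def
proof (rule cSup_upper)
  show "N (x - y) \<in> {N (x - y) |x y. x \<in> X \<and> y \<in> X}" using assms by auto
  obtain B where B: "\<And>x. x \<in> X \<Longrightarrow> norm x \<le> B" using \<open>bounded X\<close> by (auto simp: bounded_iff)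
  have S: "0 \<le> (\<Sum>b\<in>Basis. N (b::'a))" by (intro sum_nonneg is_normD(6)[OF N])
  have "N (u - v) \<le> (\<Sum>b\<in>Basis. N b) * (B + B)" if "u \<in> X" "v \<in> X" for u v
  proof -
    have "norm (u - v) \<le> B + B" using norm_triangle_ineq4[of u v] B[of u] B[of v] that by simp
    then show ?thesis using is_norm_le_norm[OF N, of "u - v"] mult_left_mono[OF _ S]
      by (meson order_trans)
  qed
  then show "bdd_above {N (x - y) |x y. x \<in> X \<and> y \<in> X}" by (auto simp: bdd_above_def)
qed

section \<open>Maxima and minima over the objectives\<close>

lemma lin_max_ge: "j \<in> {1..m} \<Longrightarrow> G j x \<bullet> (y - x) \<le> lin_max m G x y"
  unfolding lin_max_def by (rule Max_ge) auto

lemma lin_max_le: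
  assumes "1 \<le> m" "\<And>j. j \<in> {1..m} \<Longrightarrow> G j x \<bullet> (y - x) \<le> c"
  shows "lin_max m G x y \<le> c"
  unfolding lin_max_def using assms by (subst Max_le_iff) auto

lemma h_hat_le: "j \<in> {1..m} \<Longrightarrow> h_hat m F z x \<le> F j x - F j z"
  unfolding h_hat_def by (rule Min_le) auto

lemma h_hat_ge:
  assumes "1 \<le> m" "\<And>j. j \<in> {1..m} \<Longrightarrow> c \<le> F j x - F j z"
  shows "c \<le> h_hat m F z x"
  unfolding h_hat_def using assms by (subst Min_ge_iff) auto

section \<open>Estimates for a single step\<close>

text \<open>\<open>t\<close> minimises the majorant
  \<open>- t * g + L * n\<^sup>2 / 2 * t\<^sup>2\<close> over [0,1]. The first bound evaluates it
  there, the second compares with the full step 1 and is meant for the very first iteration.\<close>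

lemma short_step_decrease:
  fixes g n L a :: real
  assumes "0 < g" "0 < n" "0 < L" "a \<le> - g"
  defines "t \<equiv> min 1 (g / (L * n\<^sup>2))"
  shows "t * a + L / 2 * (t * n)\<^sup>2 \<le> - (min g (g\<^sup>2 / (L * n\<^sup>2)) / 2)"
    and "t * a + L / 2 * (t * n)\<^sup>2 \<le> - g + L * n\<^sup>2 / 2"
proof -
  define M where "M = L * n\<^sup>2"
  have M: "0 < M" using assms by (simp add: M_def)
  have t: "0 \<le> t" "t = min 1 (g / M)" using assms M by (auto simp: t_def M_def)
  have "t * a \<le> t * (- g)" using t(1) assms(4) by (rule mult_left_mono[rotated])
  then have le: "t * a + L / 2 * (t * n)\<^sup>2 \<le> - t * g + M / 2 * t\<^sup>2"
    by (simp add: M_def power_mult_distrib mult_ac)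
  have "- t * g + M / 2 * t\<^sup>2 \<le> - (min g (g\<^sup>2 / M) / 2) \<and> - t * g + M / 2 * t\<^sup>2 \<le> - g + M / 2"
  proof (cases "M \<le> g")
    case True
    then have "t = 1" using M t by (simp add: min_def)
    moreover have "g \<le> g\<^sup>2 / M" using True M assms(1) by (simp add: field_simps power2_eq_square)
    ultimately show ?thesis using True by simp
  next
    case False
    then have tM: "t = g / M" using M t by (simp add: min_def)
    have "g\<^sup>2 / M \<le> g" using False M assms(1) by (simp add: field_simps power2_eq_square)
    moreover have e: "- t * g + M / 2 * t\<^sup>2 = - (g\<^sup>2 / M / 2)"
      using M by (simp add: tM field_simps power2_eq_square)
    moreover have "- (g\<^sup>2 / M / 2) \<le> - g + M / 2"
      using M sum_squares_ge_zero[of "g - M" 0] by (simp add: field_simps power2_eq_square)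
    ultimately show ?thesis by (auto simp: min_def)
  qed
  then show "t * a + L / 2 * (t * n)\<^sup>2 \<le> - (min g (g\<^sup>2 / (L * n\<^sup>2)) / 2)"
    and "t * a + L / 2 * (t * n)\<^sup>2 \<le> - g + L * n\<^sup>2 / 2"
    using le by (auto simp: M_def)
qed

text \<open>The midpoint of \<open>x\<close> and \<open>p\<close>, pushed along \<open>z\<close>,
  stays in \<open>X\<close> and so cannot beat \<open>p\<close> in the linear problem. Its value is
  at most half that of \<open>p\<close> minus the gain of the push, so half of
  \<open>- lin_max m G x p\<close> dominates this gain.\<close>

lemma uniformly_convex_gap:
  assumes "uniformly_convex_set N \<alpha> q X" "x \<in> X" "0 \<le> \<alpha>" "1 \<le> m"
    and "is_arg_min (lin_max m G x) (\<lambda>y. y \<in> X) p"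
    and "N z \<le> 1" and z: "\<And>j. j \<in> {1..m} \<Longrightarrow> G j x \<bullet> z \<le> - s"
  shows "\<alpha> / 4 * N (p - x) powr q * s \<le> - lin_max m G x p"
proof -
  \<comment> \<open>The push that uniform convexity allows at parameter 1/2: the factor is 1/2 * 1/2
    * (\<alpha> / 2).\<close>
  define w where "w = \<alpha> / 8 * N (p - x) powr q"
  define y where "y = x + (1/2) *\<^sub>R (p - x) + w *\<^sub>R z"
  have "p \<in> X" using assms(5) by (auto simp: is_arg_min_def)
  then have "x + (1/2) *\<^sub>R (p - x) + ((1/2) * (1 - 1/2) * (\<alpha> / 2) * N (p - x) powr q) *\<^sub>R z \<in> X"
    using assms(1,2,6) unfolding uniformly_convex_set_def
    by (metis atLeastAtMost_iff divide_le_eq_1_pos half_gt_zero less_eq_real_def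
        one_le_numeral zero_less_numeral zero_less_one)
  then have "y \<in> X" by (simp add: y_def w_def)
  then have "lin_max m G x p \<le> lin_max m G x y"
    using assms(5) by (auto simp: is_arg_min_def not_less)
  also have "\<dots> \<le> lin_max m G x p / 2 - w * s"
  proof (rule lin_max_le[OF assms(4)])
    fix j assume j: "j \<in> {1..m}"
    have "G j x \<bullet> (y - x) = G j x \<bullet> (p - x) / 2 + w * (G j x \<bullet> z)"
      by (simp add: y_def inner_add_right)
    also have "\<dots> \<le> lin_max m G x p / 2 + w * (- s)"
      using lin_max_ge[OF j] z[OF j] assms(3)
      by (intro add_mono mult_left_mono divide_right_mono) (auto simp: w_def)
    finally show "G j x \<bullet> (y - x) \<le> lin_max m G x p / 2 - w * s" by simp
  qed
  finally show ?thesis by (simp add: w_def)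
qed

text \<open>The direction from \<open>x\<close> towards \<open>z\<close> is a descent direction for all objectives at once, so no
  duality between the gradients and the norm is needed.\<close>

lemma strongly_convex_gap:
  assumes N: "is_norm N" and U: "uniformly_convex_set N \<alpha> q X" and "x \<in> X" "z \<in> X" "0 \<le> \<alpha>" "1 \<le> m" "0 < \<mu>"
    and A: "is_arg_min (lin_max m G x) (\<lambda>y. y \<in> X) p"
    and S: "\<And>j. j \<in> {1..m} \<Longrightarrow> strongly_convex_over N X \<mu> (F j) (G j)"
    and h: "0 < h_hat m F z x"
  shows "\<alpha>\<^sup>2 * \<mu> / 8 * N (p - x) powr (2 * q) * h_hat m F z x \<le> (lin_max m G x p)\<^sup>2"
proof -
  define H where "H = h_hat m F z x"
  define r where "r = N (z - x)"
  have "z \<noteq> x"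
  proof
    assume "z = x"
    then show False using h h_hat_le[of 1 m F z x] assms(6) by simp
  qed
  then have r: "0 < r" using is_normD(2,6)[OF N, of "z - x"] by (simp add: r_def order_le_less)
  \<comment> \<open>Strong convexity bounds the slope of every objective from \<open>x\<close>
    towards \<open>z\<close> by \<open>- (H + \<mu> / 2 * r\<^sup>2)\<close>; dividing by
    \<open>r\<close> normalises the direction to \<open>N\<close>-length 1.\<close>
  define s where "s = (H + \<mu> / 2 * r\<^sup>2) / r"
  have H: "0 < H" using h by (simp add: H_def)
  have s0: "0 < s" using H r \<open>0 < \<mu>\<close> by (simp add: s_def add_pos_pos)
  have "\<alpha> / 4 * N (p - x) powr q * s \<le> - lin_max m G x p"
  proof (rule uniformly_convex_gap[OF U \<open>x \<in> X\<close> \<open>0 \<le> \<alpha>\<close> \<open>1 \<le> m\<close> A])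
    show "N ((1 / r) *\<^sub>R (z - x)) \<le> 1" using r by (simp add: is_normD(3)[OF N] flip: r_def)
    fix j assume j: "j \<in> {1..m}"
    have "F j x + G j x \<bullet> (z - x) + \<mu> / 2 * r\<^sup>2 \<le> F j z"
      using S[OF j] \<open>x \<in> X\<close> \<open>z \<in> X\<close> by (auto simp: strongly_convex_over_def r_def)
    then have "G j x \<bullet> (z - x) \<le> - (H + \<mu> / 2 * r\<^sup>2)"
      using h_hat_le[OF j, of F z x] by (simp add: H_def)
    then have "G j x \<bullet> (z - x) / r \<le> - (H + \<mu> / 2 * r\<^sup>2) / r"
      using r by (intro divide_right_mono) auto
    then have "G j x \<bullet> (z - x) / r \<le> - s" by (simp only: s_def minus_divide_left)
    then show "G j x \<bullet> ((1 / r) *\<^sub>R (z - x)) \<le> - s" by simp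
  qed
  then have "(\<alpha> / 4 * N (p - x) powr q * s)\<^sup>2 \<le> (- lin_max m G x p)\<^sup>2"
    using \<open>0 \<le> \<alpha>\<close> s0 by (intro power_mono) auto
  moreover have sq: "(N (p - x) powr q)\<^sup>2 = N (p - x) powr (2 * q)"
    by (simp add: power2_eq_square flip: powr_add)
  ultimately have *: "\<alpha>\<^sup>2 / 16 * N (p - x) powr (2 * q) * s\<^sup>2 \<le> (lin_max m G x p)\<^sup>2"
    by (simp add: power_mult_distrib power_divide sq)
  \<comment> \<open>AM-GM on \<open>H\<close> and \<open>\<mu> / 2 * r\<^sup>2\<close> eliminates
    the uncontrolled distance \<open>r\<close>; the constant 1/8 arises as 2/16.\<close>
  have "2 * \<mu> * H * r\<^sup>2 \<le> (H + \<mu> / 2 * r\<^sup>2)\<^sup>2"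
    using zero_le_power2[of "H - \<mu> / 2 * r\<^sup>2"] by (simp add: power2_eq_square algebra_simps)
  then have "2 * \<mu> * H \<le> s\<^sup>2" using r by (simp add: s_def power_divide field_simps)
  then have "\<alpha>\<^sup>2 / 16 * N (p - x) powr (2 * q) * (2 * \<mu> * H) \<le> \<alpha>\<^sup>2 / 16 * N (p - x) powr (2 * q) * s\<^sup>2"
    by (intro mult_left_mono) auto
  then show ?thesis using * by (simp add: H_def mult_ac)
qed

text \<open>Split \<open>g\<^sup>2\<close> into its powers with exponents 1/q and 1 - 1/q.
  \<open>gap\<close> bounds the first factor, \<open>h \<le> g\<close> the second, and the exponent
  1/q turns \<open>n powr (2 * q)\<close> into exactly the square that the denominator needs. In
  logarithms all of this is linear.\<close>

lemma progress_lower_bound: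
  fixes c g h n q L T :: real
  assumes pos: "0 < c" "0 < h" "0 < n" "0 < L" and "h \<le> g" "1 < q"
    and gap: "c * n powr (2 * q) * h \<le> g\<^sup>2"
    and T: "T = (1 / c) powr (1 / (q - 1)) * L powr (q / (q - 1))"
  shows "h * (h / T) powr (1 - 1 / q) \<le> g\<^sup>2 / (L * n\<^sup>2)"
proof -
  have g: "0 < g" using assms by simp
  have T0: "0 < T" using assms by simp
  have lT: "(1 - 1 / q) * ln T = ln L - ln c / q"
  proof -
    have "ln T = (1 / (q - 1)) * (q * ln L - ln c)"
      using pos by (simp add: T ln_mult ln_powr ln_div diff_divide_distrib)
    moreover have "(1 - 1 / q) * (1 / (q - 1)) = 1 / q" using \<open>1 < q\<close> by (simp add: field_simps)
    ultimately have "(1 - 1 / q) * ln T = 1 / q * (q * ln L - ln c)" by (simp only: mult.assoc[symmetric])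
    then show ?thesis using \<open>1 < q\<close> by (simp add: diff_divide_distrib)
  qed
  have "ln (c * n powr (2 * q) * h) \<le> ln (g\<^sup>2)" using gap pos g by (subst ln_le_cancel_iff) simp_all
  then have 1: "ln c + 2 * q * ln n + ln h \<le> 2 * ln g"
    using pos g by (simp add: ln_mult ln_powr ln_realpow)
  have "(ln c + 2 * q * ln n + ln h) / q \<le> 2 * ln g / q"
    using 1 \<open>1 < q\<close> by (intro divide_right_mono) auto
  then have 2: "ln c / q + 2 * ln n + ln h / q \<le> 2 * ln g / q"
    using \<open>1 < q\<close> by (simp add: add_divide_distrib)
  have "(1 - 1 / q) * ln h \<le> (1 - 1 / q) * ln g"
    using \<open>h \<le> g\<close> \<open>1 < q\<close> pos by (intro mult_left_mono) auto
  then have "2 * (ln h - ln h / q) \<le> 2 * (ln g - ln g / q)" by (simp add: left_diff_distrib)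
  then have "ln h + ((1 - 1 / q) * ln h - (1 - 1 / q) * ln T) \<le> 2 * ln g - (ln L + 2 * ln n)"
    unfolding lT using 2 by (simp add: left_diff_distrib)
  then have "ln (h * (h / T) powr (1 - 1 / q)) \<le> ln (g\<^sup>2 / (L * n\<^sup>2))"
    using pos g T0 by (simp add: ln_mult ln_div ln_powr ln_realpow right_diff_distrib)
  then show ?thesis using pos g T0 by (subst (asm) ln_le_cancel_iff) auto
qed

section \<open>The scalar recursion and its two regimes\<close>

text \<open>With \<open>t = s k powr b / 2\<close>, Bernoulli's inequality makes
  \<open>s k powr (- b)\<close> gain at least b / 2 per step; inverting the resulting linear lower
  bound gives the rate.\<close>

lemma powr_recursion_rate:
  fixes s :: "nat \<Rightarrow> real"
  assumes "0 < b" "b \<le> 1" "\<And>k. 0 \<le> s k" "s 0 \<le> 1"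
    and rec: "\<And>k. s (Suc k) \<le> s k - s k * min 1 (s k powr b) / 2"
  shows "s k \<le> (1 / (1 + b / 2 * real k)) powr (1 / b)"
proof -
  \<comment> \<open>Zero is a separate alternative because \<open>0 powr (- b)\<close> is 0, which
    would break the lower bound; once reached, zero persists. The bound \<open>s k \<le> 1\<close>
    keeps the minimum in the recursion equal to \<open>s k powr b\<close>.\<close>
  have "s k = 0 \<or> (0 < s k \<and> s k \<le> 1 \<and> 1 + b / 2 * real k \<le> s k powr (- b))"
  proof (induction k)
    case 0
    show ?case
      using assms(3)[of 0] assms(4) powr_mono2'[of "- b" "s 0" 1] assms(1) by (cases "s 0 = 0") auto
  next
    case (Suc k)
    show ?case
    proof (cases "s k = 0 \<or> s (Suc k) = 0")
      case True
      then show ?thesis using rec[of k] assms(3)[of "Suc k"] by auto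
    next
      case False
      then have sk: "0 < s k" "s k \<le> 1" and IH: "1 + b / 2 * real k \<le> s k powr (- b)"
        and sk': "0 < s (Suc k)"
        using Suc assms(3)[of "Suc k"] by auto
      define t where "t = s k powr b / 2"
      have p1: "s k powr b \<le> 1" using sk assms(1) by (simp add: powr_le1)
      have t: "0 < t" "t \<le> 1 / 2" using sk p1 by (auto simp: t_def)
      have r: "s (Suc k) \<le> s k * (1 - t)" using rec[of k] p1 by (simp add: t_def algebra_simps)
      have "s k * (1 - t) \<le> s k" using sk t by (simp add: mult_le_cancel_left1)
      then have le1: "s (Suc k) \<le> 1" using r sk by linarith
      \<comment> \<open>Bernoulli's inequality for the negative exponent \<open>- b\<close>, by way
        of logarithm and exponential.\<close>
      have "ln (1 - t) \<le> - t" using ln_le_minus_one[of "1 - t"] t by simp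
      then have "b * t \<le> b * (- ln (1 - t))" using assms(1) by (intro mult_left_mono) auto
      then have "1 + b * t \<le> exp (- b * ln (1 - t))"
        using exp_ge_add_one_self[of "- b * ln (1 - t)"] by linarith
      then have "1 + b * t \<le> (1 - t) powr (- b)" using t by (simp add: powr_def)
      then have "s k powr (- b) * (1 + b * t) \<le> s k powr (- b) * (1 - t) powr (- b)"
        by (intro mult_left_mono) auto
      also have "\<dots> = (s k * (1 - t)) powr (- b)" using sk t by (simp add: powr_mult)
      also have "\<dots> \<le> s (Suc k) powr (- b)"
        using r sk' assms(1) by (intro powr_mono2') auto
      finally have "s k powr (- b) * (1 + b * t) \<le> s (Suc k) powr (- b)" .
      moreover have "s k powr (- b) * (1 + b * t) = s k powr (- b) + b / 2"
        using sk by (simp add: t_def powr_minus field_simps)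
      ultimately have "1 + b / 2 * real (Suc k) \<le> s (Suc k) powr (- b)"
        using IH by (simp only: of_nat_Suc distrib_left)
      then show ?thesis using le1 sk' by blast
    qed
  qed
  then show ?thesis
  proof
    assume "0 < s k \<and> s k \<le> 1 \<and> 1 + b / 2 * real k \<le> s k powr (- b)"
    then have s: "0 < s k" "1 + b / 2 * real k \<le> 1 / s k powr b" by (auto simp: powr_minus_divide)
    have "0 < 1 + b / 2 * real k" using assms(1) by (simp add: add_pos_nonneg)
    then have "s k powr b \<le> 1 / (1 + b / 2 * real k)" using s by (simp add: field_simps)
    then have "(s k powr b) powr (1 / b) \<le> (1 / (1 + b / 2 * real k)) powr (1 / b)"
      using assms(1) by (intro powr_mono2) auto
    then show ?thesis using s assms(1) by (simp add: powr_powr)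
  qed simp
qed

text \<open>Above the level \<open>T\<close> the gap is halved in each step; a gap below \<open>T\<close> is mapped below \<open>T / 2\<close>.\<close>

lemma two_phase_halving:
  fixes h :: "nat \<Rightarrow> real"
  assumes "0 < T" "0 < b" "b \<le> 1" "\<And>k. 0 \<le> h k" "h 1 \<le> B / 2"
    and rec: "\<And>k. h (Suc k) \<le> h k - h k * min 1 ((h k / T) powr b) / 2"
    and "1 \<le> k" and K: "\<And>i. 1 \<le> i \<Longrightarrow> i < k \<Longrightarrow> 2 ^ i * T \<le> B"
  shows "h k \<le> B / 2 ^ k"
  using assms(7) K
proof (induction k rule: dec_induct)
  case base
  then show ?case using assms(5) by simp
next
  case (step k)
  have IH: "h k \<le> B / 2 ^ k" using step by auto
  \<comment> \<open>Advancing from \<open>k\<close> to \<open>Suc k\<close> uses \<open>K\<close> at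
    the index \<open>k\<close> itself, hence its strict bound.\<close>
  have TB: "T \<le> B / 2 ^ k" using step.prems[of k] step.hyps by (simp add: field_simps)
  show ?case
  proof (cases "T \<le> h k")
    case True
    then have "1 \<le> (h k / T) powr b" using assms(1,2) by (intro ge_one_powr_ge_zero) auto
    then have "h (Suc k) \<le> h k / 2" using rec[of k] by simp
    then show ?thesis using IH by simp
  next
    case False
    define s where "s = h k / T"
    have s: "0 \<le> s" "s \<le> 1" "h k = s * T" using False assms(1) assms(4)[of k] by (auto simp: s_def)
    \<comment> \<open>Here \<open>b \<le> 1\<close> enters: on [0,1] it gives
      \<open>s \<le> s powr b\<close>, so the new scaled gap is at most s - s^2 / 2, which (s - 1)^2
      >= 0 bounds by 1/2.\<close>
    have "s powr 1 \<le> s powr b" using powr_mono'[of b 1 s] s assms(3) by simp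
    then have "s \<le> min 1 (s powr b)" using s by simp
    then have "s * s \<le> s * min 1 (s powr b)" using s by (intro mult_left_mono) auto
    then have "s - s * min 1 (s powr b) / 2 \<le> 1 / 2"
      using zero_le_power2[of "s - 1"] by (simp add: power2_eq_square algebra_simps)
    then have "(s - s * min 1 (s powr b) / 2) * T \<le> 1 / 2 * T" using assms(1) by (intro mult_right_mono) auto
    moreover have "h (Suc k) \<le> (s - s * min 1 (s powr b) / 2) * T"
      using rec[of k] assms(1) by (simp add: s algebra_simps)
    ultimately show ?thesis using TB by simp
  qed
qed

section \<open>The switching index and the asymptotic order\<close>

text \<open>floor (log2 R) + 2 is the least integer exceeding log2 (2 * R), so \<open>k\<close> is
  the first positive exponent with 2^k > 2 * R. Truncation at 1 preserves the first bound and leaves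
  no index for the second.\<close>

lemma floor_log_bounds:
  fixes R :: real
  assumes "0 < R" and k: "k = nat (max (\<lfloor>log 2 R\<rfloor> + 2) 1)"
  shows "2 * R \<le> 2 ^ k" and "\<And>i. 1 \<le> i \<Longrightarrow> i < k \<Longrightarrow> 2 ^ i \<le> 2 * R"
proof -
  have R: "2 powr (log 2 R + 1) = 2 * R" using assms(1) by (simp add: powr_add)
  have "log 2 R + 1 \<le> real k" unfolding k by linarith
  then have "2 powr (log 2 R + 1) \<le> 2 powr real k" by (intro powr_mono) auto
  then show "2 * R \<le> 2 ^ k" unfolding R by (simp add: powr_realpow)
  fix i :: nat assume "1 \<le> i" "i < k"
  then have "real i \<le> log 2 R + 1" unfolding k by linarith
  then have "2 powr real i \<le> 2 powr (log 2 R + 1)" by (intro powr_mono) auto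
  then show "2 ^ i \<le> 2 * R" unfolding R by (simp add: powr_realpow)
qed

text \<open>As soon as k >= 2 * c, the shifted index k - c is at least k / 2, so the shift costs
  only a factor 2 inside the constant.\<close>

lemma bigo_shifted_powr:
  fixes A C a b c e :: real
  assumes "0 \<le> A" "0 \<le> a" "0 < b" "0 \<le> e"
  shows "(\<lambda>k. C * (A / (a + b * (real k - c))) powr e) \<in> O(\<lambda>k. 1 / real k powr e)"
proof (rule bigoI)
  show "\<forall>\<^sub>F k in sequentially. norm (C * (A / (a + b * (real k - c))) powr e)
          \<le> \<bar>C\<bar> * (2 * A / b) powr e * norm (1 / real k powr e)"
    using eventually_ge_at_top[of "nat \<lceil>max 1 (2 * c)\<rceil>"]
  proof eventually_elim
    case (elim k)
    then have k: "1 \<le> real k" "2 * c \<le> real k" by linarith+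
    then have "b * (real k / 2) \<le> b * (real k - c)" using assms by (intro mult_left_mono) auto
    then have le: "b * real k / 2 \<le> a + b * (real k - c)" using assms(2) by linarith
    have pos: "0 < b * real k / 2" using assms(3) k by simp
    then have "A / (a + b * (real k - c)) \<le> A / (b * real k / 2)"
      using assms(1) le pos by (intro divide_left_mono mult_pos_pos) auto
    moreover have "0 \<le> A / (a + b * (real k - c))" using assms(1) le pos by auto
    ultimately have "(A / (a + b * (real k - c))) powr e \<le> (2 * A / b / real k) powr e"
      using assms by (intro powr_mono2) (auto simp: mult_ac)
    also have "\<dots> = (2 * A / b) powr e / real k powr e"
      using assms k by (subst powr_divide) auto
    finally have "\<bar>C\<bar> * (A / (a + b * (real k - c))) powr e \<le> \<bar>C\<bar> * ((2 * A / b) powr e / real k powr e)"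
      by (rule mult_left_mono) simp
    then show ?case by (simp add: abs_mult)
  qed
qed

theorem theorem8:
  fixes N :: "'a::euclidean_space \<Rightarrow> real"
    and X V :: "'a set"
    and m :: nat
    and F :: "nat \<Rightarrow> 'a \<Rightarrow> real"
    and G :: "nat \<Rightarrow> 'a \<Rightarrow> 'a"
    and Ls \<mu>s :: "nat \<Rightarrow> real"
    and L \<mu> \<alpha> q D :: real
    and x p d :: "nat \<Rightarrow> 'a"
    and \<theta> :: "nat \<Rightarrow> real"
    and xs :: 'a
    and k0 :: nat
  assumes "is_norm N"
    and "X \<noteq> {}" and "convex X" and "compact X"
    and "open V" and "X \<subseteq> V"
    and "m \<ge> 1"
    and "\<And>j. j \<in> {1..m} \<Longrightarrow> convex_along V (F j)"
    and "\<And>j v. j \<in> {1..m} \<Longrightarrow> v \<in> V \<Longrightarrow> GDERIV (F j) v :> G j v"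
    and "\<And>j. j \<in> {1..m} \<Longrightarrow> continuous_on V (G j)"
    and "\<And>j. j \<in> {1..m} \<Longrightarrow> smooth_over N X (Ls j) (F j) (G j)"
    and "L = (MAX j\<in>{1..m}. Ls j)" and "L > 0"
    and "mfw_run N X m G L x p"
    and "d = (\<lambda>k. p k - x k)"
    and "\<theta> = (\<lambda>k. lin_max m G (x k) (p k))"
    and "\<exists>r. strict_mono r \<and> (x \<circ> r) \<longlonglongrightarrow> xs"
    and "\<alpha> > 0" and "q \<ge> 2" and "uniformly_convex_set N \<alpha> q X"
    and "\<And>j. j \<in> {1..m} \<Longrightarrow> \<mu>s j > 0"
    and "\<And>j. j \<in> {1..m} \<Longrightarrow> strongly_convex_over N X (\<mu>s j) (F j) (G j)"
    and "\<mu> = (MIN j\<in>{1..m}. \<mu>s j)"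
    and "D = diam_wrt N X"
    and "k0 = nat (max (\<lfloor>log 2 (D\<^sup>2 / 2 * (\<alpha>\<^sup>2 * \<mu> / (8 * L)) powr (1 / (q - 1)))\<rfloor> + 2) 1)"
  shows "(\<forall>k. 1 \<le> k \<and> k \<le> k0 \<longrightarrow> h_hat m F xs (x k) \<le> L * D\<^sup>2 / 2 ^ k) \<and>
    (\<forall>k. k > k0 \<longrightarrow> h_hat m F xs (x k) \<le>
       (8 / (\<alpha>\<^sup>2 * \<mu>)) powr (1 / (q - 1)) *
       (2 * q * L / (2 * q + (q - 1) * (real k - real k0))) powr (q / (q - 1))) \<and>
    (\<lambda>k. (8 / (\<alpha>\<^sup>2 * \<mu>)) powr (1 / (q - 1)) *
       (2 * q * L / (2 * q + (q - 1) * (real k - real k0))) powr (q / (q - 1)))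
      \<in> O(\<lambda>k. 1 / real k powr (q / (q - 1))) \<and>
    (\<forall>k l. 1 \<le> l \<and> l \<le> k \<longrightarrow>
       (\<Sum>i=l..k. min \<bar>\<theta> i\<bar> (\<bar>\<theta> i\<bar>\<^sup>2 / (L * (N (d i))\<^sup>2))) \<le> 2 * h_hat m F xs (x l))"
proof -

  \<comment> \<open>Feasibility, descent and nonnegativity of the gap along the run\<close>
  note N = assms(1) and m1 = \<open>m \<ge> 1\<close> and Lpos = \<open>L > 0\<close> and apos = \<open>\<alpha> > 0\<close> and q2 = \<open>q \<ge> 2\<close>
  note run = \<open>mfw_run N X m G L x p\<close>
  define g where "g k = - \<theta> k" for k
  define n where "n k = N (d k)" for k
  define h where "h k = h_hat m F xs (x k)" for k
  define w where "w k = min (g k) ((g k)\<^sup>2 / (L * (n k)\<^sup>2))" for k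
  have th: "\<theta> k = lin_max m G (x k) (p k)" and dk: "d k = p k - x k" for k
    by (simp_all add: assms)
  have x0: "x 0 \<in> X" and arg: "is_arg_min (lin_max m G (x k)) (\<lambda>y. y \<in> X) (p k)"
    and th0: "\<theta> k \<noteq> 0"
    and step: "x (Suc k) = x k + min 1 (g k / (L * (n k)\<^sup>2)) *\<^sub>R d k" for k
    using run by (auto simp: mfw_run_def th dk g_def n_def)
  have pX: "p k \<in> X" and th_le: "y \<in> X \<Longrightarrow> \<theta> k \<le> lin_max m G (x k) y" for k y
    using arg[of k] by (auto simp: is_arg_min_def th not_less)
  have lin: "G j (x k) \<bullet> d k \<le> - g k" if "j \<in> {1..m}" for j k
    using lin_max_ge[OF that, of G "x k" "p k"] by (simp add: g_def th dk)
  have npos: "0 < n k" for k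
  proof -
    have "d k \<noteq> 0"
    proof
      assume "d k = 0"
      then have "lin_max m G (x k) (p k) = 0" using m1 by (simp add: lin_max_def dk)
      then show False using th0[of k] th by simp
    qed
    then show ?thesis using is_normD(2,6)[OF N, of "d k"] by (simp add: n_def order_le_less)
  qed
  \<comment> \<open>Feasibility and positivity depend on each other: for feasible \<open>x k\<close>
    the candidate \<open>x k\<close> itself has value 0 in the linear problem, so \<open>g k\<close>
    is positive as the run does not stop, and this puts the step size into [0,1] for the next
    iterate.\<close>
  have xg: "x k \<in> X \<and> 0 < g k" for k
  proof -
    have gp: "0 < g k" if "x k \<in> X" for k
    proof -
      have "\<theta> k \<le> 0" using th_le[OF that] lin_max_le[OF m1, of G "x k" "x k" 0] by (auto intro: order_trans)
      then show ?thesis using th0[of k] by (simp add: g_def)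
    qed
    have "x k \<in> X"
    proof (induction k)
      case (Suc k)
      define t where "t = min 1 (g k / (L * (n k)\<^sup>2))"
      have "0 \<le> t" "t \<le> 1" using gp[OF Suc] Lpos by (auto simp: t_def)
      moreover have "x (Suc k) = (1 - t) *\<^sub>R x k + t *\<^sub>R p k"
        by (simp add: step dk algebra_simps flip: t_def)
      ultimately show ?case using \<open>convex X\<close> Suc pX[of k] by (simp add: convexD_alt)
    qed (rule x0)
    then show ?thesis using gp by blast
  qed
  then have xX: "x k \<in> X" and gpos: "0 < g k" for k by auto
  have w0: "0 \<le> w k" for k using gpos[of k] Lpos by (simp add: w_def)
  have desc: "F j (x (Suc k)) \<le> F j (x k) - w k / 2"
       "F j (x (Suc k)) \<le> F j (x k) - g k + L * (n k)\<^sup>2 / 2" if j: "j \<in> {1..m}" for j k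
  proof -
    define t where "t = min 1 (g k / (L * (n k)\<^sup>2))"
    have t0: "0 \<le> t" using gpos[of k] Lpos by (simp add: t_def)
    have e: "x (Suc k) - x k = t *\<^sub>R d k" by (simp add: step t_def)
    have "Ls j \<le> L" unfolding assms(12) using j by (intro Max_ge) auto
    then have "Ls j / 2 * (t * n k)\<^sup>2 \<le> L / 2 * (t * n k)\<^sup>2" by (intro mult_right_mono) auto
    moreover have "F j (x (Suc k)) \<le> F j (x k) + t * (G j (x k) \<bullet> d k) + Ls j / 2 * (t * n k)\<^sup>2"
      using assms(11)[OF j] xX[of k] xX[of "Suc k"] t0
      unfolding smooth_over_def by (metis e inner_scaleR_right is_normD(3)[OF N] abs_of_nonneg n_def)
    ultimately show "F j (x (Suc k)) \<le> F j (x k) - w k / 2"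
       "F j (x (Suc k)) \<le> F j (x k) - g k + L * (n k)\<^sup>2 / 2"
      using short_step_decrease[OF gpos[of k] npos[of k] Lpos lin[OF j, of k]]
      unfolding t_def w_def by linarith+
  qed
  obtain r where r: "strict_mono r" "(x \<circ> r) \<longlonglongrightarrow> xs" using assms(17) by auto
  have xsX: "xs \<in> X"
    using closed_sequentially[OF compact_imp_closed[OF \<open>compact X\<close>], of "x \<circ> r" xs] r xX by auto
  \<comment> \<open>Every objective is nonincreasing along the run, so its limit along the
    subsequence, the value at \<open>xs\<close>, bounds all iterates from below.\<close>
  have Fge: "F j xs \<le> F j (x k)" if j: "j \<in> {1..m}" for j k
  proof -
    have dec: "decseq (\<lambda>k. F j (x k))"
      unfolding decseq_Suc_iff using desc(1)[OF j] w0 by (smt (verit) divide_nonneg_nonneg)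
    have "isCont (F j) xs"
      using assms(9)[OF j, of xs] xsX \<open>X \<subseteq> V\<close> by (auto simp: gderiv_def intro: has_derivative_continuous)
    then have lim: "(\<lambda>i. F j (x (r i))) \<longlonglongrightarrow> F j xs"
      using r(2) by (auto simp: o_def intro: isCont_tendsto_compose)
    have "decseq (\<lambda>i. F j (x (r i)))"
      using dec r(1) by (auto simp: decseq_def strict_mono_less_eq)
    then have "F j xs \<le> F j (x (r k))" using lim by (rule decseq_ge)
    also have "\<dots> \<le> F j (x k)" using dec seq_suble[OF r(1), of k] by (auto simp: decseq_def)
    finally show ?thesis .
  qed
  have h0: "0 \<le> h k" for k unfolding h_def using Fge by (intro h_hat_ge m1) auto
  \<comment> \<open>\<open>xs\<close> is feasible and competes with \<open>p k\<close>; convexity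
    bounds each slope towards it by \<open>- h k\<close>.\<close>
  have hg: "h k \<le> g k" for k
  proof -
    have "lin_max m G (x k) xs \<le> - h k"
    proof (rule lin_max_le[OF m1])
      fix j assume j: "j \<in> {1..m}"
      have "F j (x k) + G j (x k) \<bullet> (xs - x k) \<le> F j xs"
        using assms(11)[OF j] xX xsX by (auto simp: smooth_over_def)
      then show "G j (x k) \<bullet> (xs - x k) \<le> - h k"
        using h_hat_le[OF j, of F xs "x k"] by (simp add: h_def)
    qed
    then show ?thesis using th_le[OF xsX, of k] by (simp add: g_def)
  qed
  have h_attained: "\<exists>j\<in>{1..m}. h k = F j (x k) - F j xs" for k
  proof -
    have "h k \<in> (\<lambda>j. F j (x k) - F j xs) ` {1..m}"
      unfolding h_def h_hat_def using m1 by (intro Min_in) auto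
    then show ?thesis by auto
  qed
  \<comment> \<open>The objective attaining the smallest gap may change with \<open>k\<close>; the
    one attaining it at \<open>k\<close> suffices, since its new gap bounds \<open>h (Suc k)\<close>
    from above.\<close>
  have hrec: "h (Suc k) \<le> h k - w k / 2" "h (Suc k) \<le> h k - g k + L * (n k)\<^sup>2 / 2" for k
  proof -
    obtain j where j: "j \<in> {1..m}" "h k = F j (x k) - F j xs" using h_attained by blast
    show "h (Suc k) \<le> h k - w k / 2" "h (Suc k) \<le> h k - g k + L * (n k)\<^sup>2 / 2"
      using desc[OF j(1), of k] h_hat_le[OF j(1), of F xs "x (Suc k)"] j(2) by (simp_all add: h_def)
  qed

  have sum_bound: "(\<Sum>i=l..k. w i) \<le> 2 * h l" if "l \<le> k" for k l
  proof -
    have "(\<Sum>i=l..k. w i) \<le> (\<Sum>i=l..k. 2 * (h i - h (Suc i)))"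
      using hrec(1) by (intro sum_mono) (smt (verit) field_sum_of_halves)
    also have "\<dots> = 2 * (h l - h (Suc k))"
      using sum_Suc_diff[of l k "\<lambda>i. - h i"] that unfolding sum_distrib_left[symmetric] by simp
    finally show ?thesis using h0[of "Suc k"] by simp
  qed

  \<comment> \<open>The scalar recursion for the smallest gap\<close>
  have muj: "\<mu> \<le> \<mu>s j" if "j \<in> {1..m}" for j unfolding assms(23) using that by (intro Min_le) auto
  have mupos: "0 < \<mu>" unfolding assms(23) using m1 assms(21) by (subst Min_gr_iff) auto
  have sc: "strongly_convex_over N X \<mu> (F j) (G j)" if j: "j \<in> {1..m}" for j
    unfolding strongly_convex_over_def
  proof (intro ballI)
    fix u v assume "u \<in> X" "v \<in> X"
    then have "F j u + G j u \<bullet> (v - u) + \<mu>s j / 2 * (N (v - u))\<^sup>2 \<le> F j v"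
      using assms(22)[OF j] by (auto simp: strongly_convex_over_def)
    moreover have "\<mu> / 2 * (N (v - u))\<^sup>2 \<le> \<mu>s j / 2 * (N (v - u))\<^sup>2"
      using muj[OF j] by (intro mult_right_mono) auto
    ultimately show "F j u + G j u \<bullet> (v - u) + \<mu> / 2 * (N (v - u))\<^sup>2 \<le> F j v" by linarith
  qed

  define c where "c = \<alpha>\<^sup>2 * \<mu> / 8"
  define b where "b = 1 - 1 / q"
  define T where "T = (1 / c) powr (1 / (q - 1)) * L powr (q / (q - 1))"
  have c: "0 < c" using apos mupos by (simp add: c_def)
  have b: "0 < b" "b \<le> 1" "b = (q - 1) / q" "1 / b = q / (q - 1)" using q2 by (auto simp: b_def field_simps)
  have T: "0 < T" using c Lpos by (simp add: T_def)
  \<comment> \<open>A vanishing gap is treated apart because the logarithmic estimate requires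
    \<open>0 < h k\<close>. Otherwise \<open>hg\<close> and the curvature estimate handle the two
    terms of the minimum in \<open>w k\<close>.\<close>
  have rec: "h (Suc k) \<le> h k - h k * min 1 ((h k / T) powr b) / 2" for k
  proof (cases "h k = 0")
    case True
    then show ?thesis using hrec(1)[of k] w0[of k] by simp
  next
    case False
    then have hp: "0 < h k" using h0[of k] by simp
    have "c * n k powr (2 * q) * h k \<le> (g k)\<^sup>2"
      using strongly_convex_gap[OF N assms(20) xX[of k] xsX _ m1 mupos arg[of k] sc] apos hp
      by (simp add: c_def n_def dk g_def th h_def)
    then have "h k * (h k / T) powr b \<le> (g k)\<^sup>2 / (L * (n k)\<^sup>2)"
      unfolding b_def using q2 by (intro progress_lower_bound[OF c hp npos Lpos hg _ _ T_def]) auto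
    then have "h k * min 1 ((h k / T) powr b) \<le> w k"
      using hg[of k] h0[of k] by (auto simp: w_def min_mult_distrib_left)
    then show ?thesis using hrec(1)[of k] by simp
  qed

  \<comment> \<open>The first step and the index where the regimes change\<close>
  have nD: "n k \<le> D" for k
    unfolding n_def dk assms(24) using pX xX \<open>compact X\<close>
    by (intro le_diam_wrt[OF N]) (auto intro: compact_imp_bounded)
  then have Dpos: "0 < D" using npos[of 0] by (meson less_le_trans)
  \<comment> \<open>The full-step bound cancels \<open>h 0\<close> against \<open>g 0\<close>, so
    the geometric rate starts at index 1 with one factor 1/2 already gained.\<close>
  have h1: "h 1 \<le> L * D\<^sup>2 / 2"
  proof -
    have "(n 0)\<^sup>2 \<le> D\<^sup>2" using nD[of 0] npos[of 0] by (intro power_mono) auto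
    then have "L * (n 0)\<^sup>2 \<le> L * D\<^sup>2" using Lpos by (intro mult_left_mono) auto
    then show ?thesis using hrec(2)[of 0] hg[of 0] by simp
  qed
  define R where "R = D\<^sup>2 / 2 * (\<alpha>\<^sup>2 * \<mu> / (8 * L)) powr (1 / (q - 1))"
  have R: "0 < R" using Dpos apos mupos Lpos by (simp add: R_def)
  have k0: "k0 = nat (max (\<lfloor>log 2 R\<rfloor> + 2) 1)" unfolding R_def by (rule assms(25))
  \<comment> \<open>One factor \<open>L\<close> splits off the power in \<open>T\<close> and the
    rest cancels against \<open>R\<close>. The resulting identity \<open>RT\<close> says that
    \<open>L * D\<^sup>2 / 2 ^ k\<close> is at most \<open>T\<close> exactly when
    \<open>2 ^ k\<close> is at least \<open>2 * R\<close>, which ties \<open>k0\<close> to the level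
    \<open>T\<close>.\<close>
  have "q / (q - 1) = 1 + 1 / (q - 1)" using q2 by (simp add: field_simps)
  then have "L powr (q / (q - 1)) = L * L powr (1 / (q - 1))" using Lpos by (simp only: powr_add) simp
  moreover have "(\<alpha>\<^sup>2 * \<mu> / (8 * L)) powr (1 / (q - 1)) = c powr (1 / (q - 1)) / L powr (1 / (q - 1))"
    using c Lpos by (simp add: c_def flip: powr_divide)
  moreover have "(1 / c) powr (1 / (q - 1)) = 1 / c powr (1 / (q - 1))"
    using c by (simp add: powr_divide)
  ultimately have RT: "2 * R * T = L * D\<^sup>2"
    using c Lpos by (simp add: R_def T_def)

  \<comment> \<open>The two regimes\<close>
  have phase1: "h k \<le> L * D\<^sup>2 / 2 ^ k" if "1 \<le> k" "k \<le> k0" for k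
  proof (rule two_phase_halving[OF T b(1,2) h0 h1 rec that(1)])
    fix i assume "1 \<le> i" "i < k"
    then have "2 ^ i \<le> 2 * R" using floor_log_bounds(2)[OF R k0, of i] that by simp
    then have "2 ^ i * T \<le> 2 * R * T" using T by (intro mult_right_mono) auto
    then show "2 ^ i * T \<le> L * D\<^sup>2" by (simp only: RT)
  qed
  have hk0: "h k0 \<le> T"
  proof -
    have "1 \<le> k0" unfolding k0 by simp
    then have "h k0 \<le> 2 * R * T / 2 ^ k0" using phase1[of k0] by (simp only: RT)
    also have "\<dots> \<le> 2 ^ k0 * T / 2 ^ k0"
      using floor_log_bounds(1)[OF R k0] T by (intro divide_right_mono mult_right_mono) auto
    finally show ?thesis by simp
  qed
  have phase2: "h k \<le> (8 / (\<alpha>\<^sup>2 * \<mu>)) powr (1 / (q - 1)) *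
       (2 * q * L / (2 * q + (q - 1) * (real k - real k0))) powr (q / (q - 1))" if "k0 < k" for k
  proof -
    \<comment> \<open>The recursion restarts at \<open>k0\<close> for the gaps divided by
      \<open>T\<close>, the first of which is at most 1 by \<open>hk0\<close>.\<close>
    define y where "y = 1 / (1 + b / 2 * real (k - k0))"
    have "h (k0 + (k - k0)) / T \<le> y powr (1 / b)" unfolding y_def
    proof (rule powr_recursion_rate[OF b(1,2)])
      fix i
      show "h (k0 + Suc i) / T \<le> h (k0 + i) / T - h (k0 + i) / T * min 1 ((h (k0 + i) / T) powr b) / 2"
        using divide_right_mono[OF rec[of "k0 + i"], of T] T by (simp add: diff_divide_distrib)
    qed (use h0 T hk0 in auto)
    then have "h k \<le> T * y powr (1 / b)" using T that by (simp add: field_simps)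
    \<comment> \<open>Since 1 / b = q / (q - 1), the power of \<open>L\<close> in \<open>T\<close>
      merges with that of \<open>y\<close>.\<close>
    also have "\<dots> = (1 / c) powr (1 / (q - 1)) * (L * y) powr (q / (q - 1))"
    proof -
      have "0 \<le> y" using b(1) by (simp add: y_def)
      then show ?thesis using Lpos by (simp add: T_def b(4) powr_mult)
    qed
    also have "L * y = 2 * q * L / (2 * q + (q - 1) * (real k - real k0))"
    proof -
      have "1 + b / 2 * real (k - k0) = (2 * q + (q - 1) * (real k - real k0)) / (2 * q)"
        using q2 that by (simp add: b(3) field_simps)
      then show ?thesis by (simp add: y_def)
    qed
    finally show ?thesis by (simp add: c_def)
  qed
  have "\<forall>k l. 1 \<le> l \<and> l \<le> k \<longrightarrow>
       (\<Sum>i=l..k. min \<bar>\<theta> i\<bar> (\<bar>\<theta> i\<bar>\<^sup>2 / (L * (N (d i))\<^sup>2))) \<le> 2 * h_hat m F xs (x l)"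
  proof -
    have "min \<bar>\<theta> i\<bar> (\<bar>\<theta> i\<bar>\<^sup>2 / (L * (N (d i))\<^sup>2)) = w i" for i
      using gpos[of i] by (simp add: w_def g_def n_def)
    then show ?thesis using sum_bound by (simp add: h_def)
  qed
  moreover have "(\<lambda>k. (8 / (\<alpha>\<^sup>2 * \<mu>)) powr (1 / (q - 1)) *
       (2 * q * L / (2 * q + (q - 1) * (real k - real k0))) powr (q / (q - 1)))
      \<in> O(\<lambda>k. 1 / real k powr (q / (q - 1)))"
    using Lpos q2 by (intro bigo_shifted_powr) auto
  ultimately show ?thesis using phase1 phase2 unfolding h_def by blast
qed

end
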